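(* Let $g\in\mathcal{B}_0$ be non-constant and $\gamma>0$. (i) Both of the operators $V_g\colon A^{-\gamma}\to A^{-\gamma}$ and $V_g\colon A^{-\gamma}_0\to A^{-\gamma}_0$ fail to have closed range. (ii) Each of the containments $A^{-\gamma}\subseteq[V_g,A^{-\gamma}]$ and $A^{-\gamma}_0\subseteq[V_g,A^{-\gamma}_0]$ is proper. (iii) Both of the operators $T_g\colon A^{-\gamma}\to A^{-\gamma}$ and $T_g\colon A^{-\gamma}_0\to A^{-\gamma}_0$ fail to have closed range. (iv) Each of the containments $A^{-\gamma}\subseteq[T_g,A^{-\gamma}]$ and $A^{-\gamma}_0\subseteq[T_g,A^{-\gamma}_0]$ is proper.
   Context: $\mathbb{D}$ is the open unit disc in $\mathbb{C}$ and $H(\mathbb{D})$ is the space of analytic functions on $\mathbb{D}$. For $\gamma>0$, $A^{-\gamma}:=\{f\in H(\mathbb{D}): \|f\|_{-\gamma}:=\sup_{z\in\mathbb{D}}(1-|z|)^\gamma|f(z)|<\infty\}$ and $A^{-\gamma}_0:=\{f\in H(\mathbb{D}): \lim_{|z|\to1^-}(1-|z|)^\gamma|f(z)|=0\}$, both Banach spaces with norm $\|\cdot\|_{-\gamma}$. The Bloch space is $\mathcal{B}:=\{g\in H(\mathbb{D}): \sup_{z\in\mathbb{D}}(1-|z|)|g'(z)|<\infty\}$ and the little Bloch space is $\mathcal{B}_0:=\{g\in\mathcal{B}: \lim_{|z|\to1^-}(1-|z|)|g'(z)|=0\}$. For $f\in H(\mathbb{D})$: $(V_gf)(z):=\int_0^zf(\xi)g'(\xi)\,d\xi$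 for $z\in\mathbb{D}$; and $(T_gf)(z):=\frac1z\int_0^zf(\xi)g'(\xi)\,d\xi$ for $z\in\mathbb{D}\setminus\{0\}$, $(T_gf)(0):=f(0)g'(0)$. For $g\in\mathcal{B}$ both $V_g$ and $T_g$ map each of $A^{-\gamma}$ and $A^{-\gamma}_0$ continuously into itself. For $R\in\{V_g,T_g\}$ and $X\in\{A^{-\gamma},A^{-\gamma}_0\}$, the optimal domain is $[R,X]:=\{f\in H(\mathbb{D}): Rf\in X\}$. *)

theory Defs
  imports "HOL-Complex_Analysis.Complex_Analysis"
begin

abbreviation unit_disc :: "complex set" where
  "unit_disc \<equiv> ball 0 1"

text \<open>The filter for the limit as the modulus of z tends to 1 from below, uniformly in the
  argument of z.\<close>

abbreviation to_circle :: "complex filter" where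
  "to_circle \<equiv> filtercomap cmod (at_left 1)"

text \<open>Elements of H(D) are functions on the disc only. They are represented by the extensional
  functions (constantly \<^const>\<open>undefined\<close> off the disc), so that HOL equality is equality on
  the disc and the norm below separates points.\<close>

definition hol_disc :: "(complex \<Rightarrow> complex) set" where
  "hol_disc = {f \<in> extensional unit_disc. f holomorphic_on unit_disc}"

definition growth_space :: "real \<Rightarrow> (complex \<Rightarrow> complex) set" where
  "growth_space \<gamma> =
     {f \<in> hol_disc. bdd_above ((\<lambda>z. (1 - cmod z) powr \<gamma> * cmod (f z)) ` unit_disc)}"

definition growth_space0 :: "real \<Rightarrow> (complex \<Rightarrow> complex) set" where
  "growth_space0 \<gamma> =
     {f \<in> hol_disc. ((\<lambda>z. (1 - cmod z) powr \<gamma> * cmod (f z)) \<longlongrightarrow> 0) to_circle}"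

definition growth_norm :: "real \<Rightarrow> (complex \<Rightarrow> complex) \<Rightarrow> real" where
  "growth_norm \<gamma> f = (SUP z\<in>unit_disc. (1 - cmod z) powr \<gamma> * cmod (f z))"

text \<open>The guard only matters off the normed space, where the supremum is unspecified; the locale
  \<^locale>\<open>Metric_space\<close> asks for a nonnegative distance on the whole type.\<close>

definition growth_dist ::
    "real \<Rightarrow> (complex \<Rightarrow> complex) \<Rightarrow> (complex \<Rightarrow> complex) \<Rightarrow> real" where
  "growth_dist \<gamma> f h =
     (if f \<in> growth_space \<gamma> \<and> h \<in> growth_space \<gamma>
      then growth_norm \<gamma> (\<lambda>z. f z - h z) else 0)"

definition bloch :: "(complex \<Rightarrow> complex) set" where
  "bloch = {g \<in> hol_disc. bdd_above ((\<lambda>z. (1 - cmod z) * cmod (deriv g z)) ` unit_disc)}"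

definition little_bloch :: "(complex \<Rightarrow> complex) set" where
  "little_bloch = {g \<in> bloch. ((\<lambda>z. (1 - cmod z) * cmod (deriv g z)) \<longlongrightarrow> 0) to_circle}"

text \<open>The integrand is holomorphic on the disc, so the integral from 0 to z does not depend on
  the path; the segment is used.\<close>

definition V_op :: "(complex \<Rightarrow> complex) \<Rightarrow> (complex \<Rightarrow> complex) \<Rightarrow> complex \<Rightarrow> complex" where
  "V_op g f =
     (\<lambda>z\<in>unit_disc. contour_integral (linepath 0 z) (\<lambda>\<xi>. f \<xi> * deriv g \<xi>))"

definition T_op :: "(complex \<Rightarrow> complex) \<Rightarrow> (complex \<Rightarrow> complex) \<Rightarrow> complex \<Rightarrow> complex" where
  "T_op g f =
     (\<lambda>z\<in>unit_disc. if z = 0 then f 0 * deriv g 0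
        else 1 / z * contour_integral (linepath 0 z) (\<lambda>\<xi>. f \<xi> * deriv g \<xi>))"

definition optimal_domain ::
    "((complex \<Rightarrow> complex) \<Rightarrow> complex \<Rightarrow> complex) \<Rightarrow> (complex \<Rightarrow> complex) set
      \<Rightarrow> (complex \<Rightarrow> complex) set" where
  "optimal_domain R X = {f \<in> hol_disc. R f \<in> X}"

text \<open>For an operator R that maps X into itself. If R did not map X into X, the right-hand side
  would be false for that reason alone; the inclusion of X in \<^term>\<open>optimal_domain R X\<close> says
  that this does not happen.\<close>

definition has_closed_range ::
    "real \<Rightarrow> (complex \<Rightarrow> complex) set \<Rightarrow> ((complex \<Rightarrow> complex) \<Rightarrow> complex \<Rightarrow> complex) \<Rightarrow> bool" where
  "has_closed_range \<gamma> X R \<longleftrightarrow>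
     closedin (Metric_space.mtopology X (growth_dist \<gamma>)) (R ` X)"

text \<open>The two spaces are metric spaces under the norm distance, so
  \<^const>\<open>Metric_space.mtopology\<close> is the norm topology in the definition above.\<close>

lemma growth_space_diff_bdd:
  assumes "f \<in> growth_space \<gamma>" "h \<in> growth_space \<gamma>"
  shows "bdd_above ((\<lambda>z. (1 - cmod z) powr \<gamma> * cmod (f z - h z)) ` unit_disc)"
proof -
  obtain a b where a: "\<And>z. z \<in> unit_disc \<Longrightarrow> (1 - cmod z) powr \<gamma> * cmod (f z) \<le> a"
    and b: "\<And>z. z \<in> unit_disc \<Longrightarrow> (1 - cmod z) powr \<gamma> * cmod (h z) \<le> b"
    using assms unfolding growth_space_def bdd_above_def by (simp del: mem_ball_0 mem_ball) blast
  show ?thesis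
  proof (rule bdd_aboveI2)
    fix z :: complex assume z: "z \<in> unit_disc"
    have "(1 - cmod z) powr \<gamma> * cmod (f z - h z)
        \<le> (1 - cmod z) powr \<gamma> * (cmod (f z) + cmod (h z))"
      by (intro mult_left_mono norm_triangle_ineq4) auto
    also have "\<dots> \<le> a + b" using a[OF z] b[OF z] by (simp add: distrib_left)
    finally show "(1 - cmod z) powr \<gamma> * cmod (f z - h z) \<le> a + b" .
  qed
qed

lemma growth_dist_upper:
  assumes "f \<in> growth_space \<gamma>" "h \<in> growth_space \<gamma>" "z \<in> unit_disc"
  shows "(1 - cmod z) powr \<gamma> * cmod (f z - h z) \<le> growth_dist \<gamma> f h"
  using cSUP_upper[OF assms(3) growth_space_diff_bdd[OF assms(1,2)]] assms(1,2)
  by (simp add: growth_dist_def growth_norm_def)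

lemma Metric_space_growth_space: "Metric_space (growth_space \<gamma>) (growth_dist \<gamma>)"
proof
  fix f h :: "complex \<Rightarrow> complex"
  show "growth_dist \<gamma> f h = growth_dist \<gamma> h f"
    by (simp add: growth_dist_def growth_norm_def norm_minus_commute)
  show "0 \<le> growth_dist \<gamma> f h"
  proof (cases "f \<in> growth_space \<gamma> \<and> h \<in> growth_space \<gamma>")
    case True
    have "0 \<le> (1 - cmod 0) powr \<gamma> * cmod (f 0 - h 0)" by simp
    also have "\<dots> \<le> growth_dist \<gamma> f h" using True by (intro growth_dist_upper) auto
    finally show ?thesis .
  qed (auto simp: growth_dist_def)
next
  fix f h :: "complex \<Rightarrow> complex"
  assume fh: "f \<in> growth_space \<gamma>" "h \<in> growth_space \<gamma>"
  show "growth_dist \<gamma> f h = 0 \<longleftrightarrow> f = h"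
  proof
    assume d: "growth_dist \<gamma> f h = 0"
    show "f = h"
    proof (rule extensionalityI)
      show "f \<in> extensional unit_disc" "h \<in> extensional unit_disc"
        using fh by (auto simp: growth_space_def hol_disc_def)
      fix z :: complex assume z: "z \<in> unit_disc"
      have "(1 - cmod z) powr \<gamma> * cmod (f z - h z) \<le> 0"
        using growth_dist_upper[OF fh z] d by simp
      moreover have "(1 - cmod z) powr \<gamma> > 0" using z by simp
      ultimately show "f z = h z" by (simp add: mult_le_0_iff)
    qed
  qed (simp add: growth_dist_def growth_norm_def)
next
  fix f h k :: "complex \<Rightarrow> complex"
  assume m: "f \<in> growth_space \<gamma>" "h \<in> growth_space \<gamma>" "k \<in> growth_space \<gamma>"
  have "growth_norm \<gamma> (\<lambda>z. f z - k z) \<le> growth_dist \<gamma> f h + growth_dist \<gamma> h k"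
    unfolding growth_norm_def
  proof (rule cSUP_least)
    fix z :: complex assume z: "z \<in> unit_disc"
    have "(1 - cmod z) powr \<gamma> * cmod (f z - k z)
        \<le> (1 - cmod z) powr \<gamma> * (cmod (f z - h z) + cmod (h z - k z))"
      by (intro mult_left_mono) (auto intro: norm_diff_triangle_le)
    also have "\<dots> \<le> growth_dist \<gamma> f h + growth_dist \<gamma> h k"
      using growth_dist_upper[OF m(1,2) z] growth_dist_upper[OF m(2,3) z]
      by (simp add: distrib_left)
    finally show "(1 - cmod z) powr \<gamma> * cmod (f z - k z)
        \<le> growth_dist \<gamma> f h + growth_dist \<gamma> h k" .
  qed auto
  then show "growth_dist \<gamma> f k \<le> growth_dist \<gamma> f h + growth_dist \<gamma> h k"
    using m by (simp add: growth_dist_def[of \<gamma> f k])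
qed

lemma growth_space0_subset: "growth_space0 \<gamma> \<subseteq> growth_space \<gamma>"
proof
  fix f assume f: "f \<in> growth_space0 \<gamma>"
  let ?w = "\<lambda>z. (1 - cmod z) powr \<gamma> * cmod (f z)"
  have hol: "f \<in> hol_disc" and lim: "(?w \<longlongrightarrow> 0) to_circle"
    using f by (auto simp: growth_space0_def)
  have "\<forall>\<^sub>F z in to_circle. ?w z < 1"
    using order_tendstoD(2)[OF lim, of 1] by simp
  then obtain Q where Q: "eventually Q (at_left 1)" "\<And>z. Q (cmod z) \<Longrightarrow> ?w z < 1"
    unfolding eventually_filtercomap by blast
  obtain r where r: "r < 1" "\<And>x. r < x \<Longrightarrow> x < 1 \<Longrightarrow> Q x"
    using Q(1) unfolding eventually_at_left_field by blast
  have "continuous_on unit_disc f"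
    using hol by (auto simp: hol_disc_def intro: holomorphic_on_imp_continuous_on)
  then have "continuous_on (cball 0 r) f"
    by (rule continuous_on_subset) (use r in auto)
  then have "continuous_on (cball 0 r) ?w"
    by (intro continuous_intros) (use r in auto)
  then have "bdd_above (?w ` cball 0 r)"
    by (intro bounded_imp_bdd_above compact_imp_bounded compact_continuous_image) auto
  then obtain C where C: "\<And>z. z \<in> cball 0 r \<Longrightarrow> ?w z \<le> C"
    unfolding bdd_above_def by (simp del: mem_cball_0 mem_cball) blast
  have "bdd_above (?w ` unit_disc)"
  proof (rule bdd_aboveI2)
    fix z :: complex assume z: "z \<in> unit_disc"
    show "?w z \<le> max C 1"
    proof (cases "cmod z \<le> r")
      case True
      then show ?thesis using C[of z] by auto
    next
      case False
      then show ?thesis using Q(2)[of z] r(2)[of "cmod z"] z by auto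
    qed
  qed
  with hol show "f \<in> growth_space \<gamma>" by (simp add: growth_space_def)
qed

lemma Metric_space_growth_space0: "Metric_space (growth_space0 \<gamma>) (growth_dist \<gamma>)"
  using Metric_space.subspace[OF Metric_space_growth_space growth_space0_subset] .

end

theory Submission
  imports Defs
begin

text \<open>Since the derivative of g is small relative to the weight near the circle, each of the two
  operators R is injective and sends the normalised powers
  \<open>e\<^sub>k(z) = z\<^sup>k / \<parallel>z\<^sup>k\<parallel>\<close> to functions of norm tending to 0. Hence there are
  \<open>m\<^sub>0 < m\<^sub>1 < \<dots>\<close> for which \<open>(n + 1) \<parallel>R e\<^bsub>m\<^sub>n\<^esub>\<parallel> \<le> 2\<^sup>-\<^sup>n\<close>. The lacunary
  series \<open>f = \<Sum>\<^sub>n (n + 1) e\<^bsub>m\<^sub>n\<^esub>\<close> is holomorphic on the disc, and Cauchy's estimates for its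
  coefficients show that it has infinite norm, while \<open>R f\<close> is the norm limit of the images of
  the partial sums. So f witnesses that the inclusion in the optimal domain is proper and, by
  injectivity, that the range of R is not closed; it serves both spaces at once because R maps the
  larger space into the smaller one.\<close>

section \<open>Weighted bounds and limits at the circle\<close>

lemma eventually_to_circle:
  "eventually P to_circle \<longleftrightarrow> (\<exists>r<1. \<forall>z. r < cmod z \<longrightarrow> cmod z < 1 \<longrightarrow> P z)"
proof
  assume "eventually P to_circle"
  then obtain Q where Q: "eventually Q (at_left 1)" "\<And>z. Q (cmod z) \<Longrightarrow> P z"
    unfolding eventually_filtercomap by blast
  then show "\<exists>r<1. \<forall>z. r < cmod z \<longrightarrow> cmod z < 1 \<longrightarrow> P z"
    unfolding eventually_at_left_field by blast
next
  assume "\<exists>r<1. \<forall>z. r < cmod z \<longrightarrow> cmod z < 1 \<longrightarrow> P z"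
  then obtain r where r: "r < 1" "\<And>z. r < cmod z \<Longrightarrow> cmod z < 1 \<Longrightarrow> P z" by blast
  have "eventually (\<lambda>x. r < x \<and> x < 1) (at_left 1)"
    unfolding eventually_at_left_field using r(1) by blast
  then show "eventually P to_circle"
    unfolding eventually_filtercomap using r(2) by blast
qed

lemma weight_mult_le_iff:
  assumes "cmod z < 1"
  shows "(1 - cmod z) powr s * x \<le> y \<longleftrightarrow> x \<le> y * (1 - cmod z) powr (- s)"
  using assms by (simp add: powr_minus field_simps)

lemma weight_inverse_ge_1:
  assumes "cmod z < 1" "s \<ge> 0"
  shows "1 \<le> (1 - cmod z) powr (- s)"
  using assms powr_mono2'[of "- s" "1 - cmod z" 1] by simp

text \<open>Up to some radius the constant C works by compactness; beyond it the limit leaves only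
  the \<open>\<epsilon>\<close> term. Additive bounds of this kind, unlike the limit itself, can be
  integrated along a ray.\<close>

lemma vanishing_imp_split:
  assumes cont: "continuous_on unit_disc h"
    and lim: "((\<lambda>z. (1 - cmod z) powr s * cmod (h z)) \<longlongrightarrow> 0) to_circle"
    and "\<epsilon> > 0"
  obtains C where "C \<ge> 0"
    "\<And>z. z \<in> unit_disc \<Longrightarrow> cmod (h z) \<le> C + \<epsilon> * (1 - cmod z) powr (- s)"
proof -
  have "\<forall>\<^sub>F z in to_circle. (1 - cmod z) powr s * cmod (h z) < \<epsilon>"
    using order_tendstoD(2)[OF lim] \<open>\<epsilon> > 0\<close> by simp
  then obtain r where r: "r < 1"
    "\<And>z. r < cmod z \<Longrightarrow> cmod z < 1 \<Longrightarrow> (1 - cmod z) powr s * cmod (h z) < \<epsilon>"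
    unfolding eventually_to_circle by blast
  have "continuous_on (cball 0 r) h"
    by (rule continuous_on_subset[OF cont]) (use r in auto)
  then have "bounded (h ` cball 0 r)"
    by (intro compact_imp_bounded compact_continuous_image) auto
  then obtain C where C: "C > 0" "\<And>z. cmod z \<le> r \<Longrightarrow> cmod (h z) \<le> C"
    unfolding bounded_pos by auto
  show ?thesis
  proof
    fix z :: complex assume z: "z \<in> unit_disc"
    show "cmod (h z) \<le> C + \<epsilon> * (1 - cmod z) powr (- s)"
    proof (cases "cmod z \<le> r")
      case True
      then show ?thesis using C(2)[of z] \<open>\<epsilon> > 0\<close> by (simp add: add_increasing2)
    next
      case False
      then have "(1 - cmod z) powr s * cmod (h z) \<le> \<epsilon>" using r(2)[of z] z by simp
      then show ?thesis using weight_mult_le_iff[of z s "cmod (h z)" \<epsilon>] z C(1) by simp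
    qed
  qed (use C in simp)
qed

text \<open>Since s > 0, the weight tends to 0 and absorbs the constant C, whatever its
  size.\<close>

lemma split_imp_vanishing:
  assumes "s > 0"
    and split: "\<And>\<epsilon>. \<epsilon> > 0 \<Longrightarrow>
      \<exists>C. \<forall>z\<in>unit_disc. cmod (h z) \<le> C + \<epsilon> * (1 - cmod z) powr (- s)"
  shows "((\<lambda>z. (1 - cmod z) powr s * cmod (h z)) \<longlongrightarrow> 0) to_circle"
proof (rule tendstoI)
  fix e :: real assume e: "e > 0"
  obtain C where C: "\<And>z. z \<in> unit_disc \<Longrightarrow> cmod (h z) \<le> C + e / 2 * (1 - cmod z) powr (- s)"
    using split[of "e / 2"] e half_gt_zero by blast
  \<comment> \<open>Chosen so that \<open>\<delta> * (\<bar>C\<bar> + 1) = e / 2\<close>; the added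
    1 covers C = 0, and C may be negative. The radius used below is the one where the weight equals
    \<open>\<delta>\<close>.\<close>
  define \<delta> where "\<delta> = e / (2 * (\<bar>C\<bar> + 1))"
  have \<delta>: "\<delta> > 0" using e by (simp add: \<delta>_def)
  show "\<forall>\<^sub>F z in to_circle. dist ((1 - cmod z) powr s * cmod (h z)) 0 < e"
    unfolding eventually_to_circle
  proof (intro exI[of _ "1 - \<delta> powr (1 / s)"] conjI allI impI)
    show "1 - \<delta> powr (1 / s) < 1" using \<delta> by simp
    fix z :: complex assume z: "1 - \<delta> powr (1 / s) < cmod z" "cmod z < 1"
    have "(1 - cmod z) powr s < (\<delta> powr (1 / s)) powr s"
      using z \<open>s > 0\<close> by (intro powr_less_mono2) auto
    also have "\<dots> = \<delta>" using \<delta> \<open>s > 0\<close> by (simp add: powr_powr)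
    finally have w: "(1 - cmod z) powr s < \<delta>" .
    have "(1 - cmod z) powr s * cmod (h z)
        \<le> (1 - cmod z) powr s * (C + e / 2 * (1 - cmod z) powr (- s))"
      using C[of z] z by (intro mult_left_mono) auto
    also have "\<dots> = (1 - cmod z) powr s * C + e / 2"
      using z by (simp add: powr_minus field_simps)
    also have "\<dots> \<le> (1 - cmod z) powr s * \<bar>C\<bar> + e / 2"
      by (intro add_right_mono mult_left_mono) auto
    also have "\<dots> \<le> \<delta> * \<bar>C\<bar> + e / 2"
      using w by (intro add_right_mono mult_right_mono) auto
    also have "\<dots> < \<delta> * (\<bar>C\<bar> + 1) + e / 2" using \<delta> by (simp add: algebra_simps)
    also have "\<dots> = e" by (simp add: \<delta>_def field_simps)
    finally show "dist ((1 - cmod z) powr s * cmod (h z)) 0 < e" by simp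
  qed
qed

lemma growth_space_iff:
  "f \<in> growth_space s \<longleftrightarrow>
     f \<in> hol_disc \<and> (\<exists>M. \<forall>z\<in>unit_disc. cmod (f z) \<le> M * (1 - cmod z) powr (- s))"
  by (auto simp: growth_space_def bdd_above_def weight_mult_le_iff)

lemma hol_disc_iff: "f \<in> hol_disc \<longleftrightarrow> f \<in> extensional unit_disc \<and> f holomorphic_on unit_disc"
  by (simp add: hol_disc_def)

lemma restrict_in_hol_disc: "f holomorphic_on unit_disc \<Longrightarrow> restrict f unit_disc \<in> hol_disc"
  unfolding hol_disc_iff by (metis holomorphic_transform restrict_apply' restrict_extensional)

text \<open>Trades the limit for pointwise bounds of the shape that integration against
  \<open>deriv g\<close> produces; every membership proof for R f goes through this form.\<close>

lemma growth_space0_iff: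
  assumes "s > 0"
  shows "f \<in> growth_space0 s \<longleftrightarrow> f \<in> hol_disc \<and>
     (\<forall>\<epsilon>>0. \<exists>C. \<forall>z\<in>unit_disc. cmod (f z) \<le> C + \<epsilon> * (1 - cmod z) powr (- s))"
    (is "_ \<longleftrightarrow> _ \<and> ?split")
proof -
  have "?split" if "f \<in> hol_disc" "((\<lambda>z. (1 - cmod z) powr s * cmod (f z)) \<longlongrightarrow> 0) to_circle"
  proof (intro allI impI)
    fix \<epsilon> :: real assume "\<epsilon> > 0"
    have "continuous_on unit_disc f"
      using that by (simp add: hol_disc_iff holomorphic_on_imp_continuous_on)
    from vanishing_imp_split[OF this that(2) \<open>\<epsilon> > 0\<close>]
    show "\<exists>C. \<forall>z\<in>unit_disc. cmod (f z) \<le> C + \<epsilon> * (1 - cmod z) powr (- s)" by metis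
  qed
  then show ?thesis
    using split_imp_vanishing[OF assms, of f] by (auto simp: growth_space0_def)
qed

section \<open>Growth of primitives\<close>

lemma has_derivative_ray:
  fixes F :: "complex \<Rightarrow> complex"
  assumes "(F has_field_derivative D) (at (of_real t * z))"
  shows "((\<lambda>t. F (of_real t * z)) has_vector_derivative z * D) (at t)"
proof -
  have "((\<lambda>t. complex_of_real t * z) has_vector_derivative z) (at t)"
    by (auto intro!: derivative_eq_intros)
  from field_vector_diff_chain_at[OF this assms] show ?thesis by (simp add: o_def mult.commute)
qed

text \<open>On the segment from 0 to z, F is compared with an explicit real majorant through the
  mean value inequality. Integrating the weight to the power -s-1 lowers the order of growth by one
  and yields the factor 1 / s.\<close>

lemma primitive_ray_bound:
  fixes F :: "complex \<Rightarrow> complex"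
  assumes s: "s > 0" and z: "cmod z < 1" and CD: "D \<ge> 0"
    and F: "\<And>\<xi>. cmod \<xi> < 1 \<Longrightarrow> (F has_field_derivative h \<xi>) (at \<xi>)" and F0: "F 0 = 0"
    and h: "\<And>\<xi>. cmod \<xi> \<le> cmod z \<Longrightarrow> cmod (h \<xi>) \<le> C + D * (1 - cmod \<xi>) powr (- s - 1)"
  shows "cmod (F z) \<le> C * cmod z + D / s * (1 - cmod z) powr (- s)"
proof -
  define r where "r = cmod z"
  define \<phi> where "\<phi> = (\<lambda>t. C * r * t + D / s * (1 - r * t) powr (- s))"
  define \<phi>' where "\<phi>' = (\<lambda>t. r * (C + D * (1 - r * t) powr (- s - 1)))"
  have r: "0 \<le> r" "r < 1" using z by (auto simp: r_def)
  have rt: "r * t < 1" "r * t \<le> r" "0 \<le> r * t" if "0 \<le> t" "t \<le> 1" for t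
    using that r mult_left_mono[of t 1 r] by auto
  have \<phi>: "(\<phi> has_vector_derivative \<phi>' t) (at t)" if "0 \<le> t" "t \<le> 1" for t
    unfolding \<phi>_def \<phi>'_def has_real_derivative_iff_has_vector_derivative[symmetric]
    using rt[OF that] s by (auto intro!: derivative_eq_intros simp: algebra_simps)
  have f: "((\<lambda>t. F (of_real t * z)) has_vector_derivative z * h (of_real t * z)) (at t)"
    if "0 \<le> t" "t \<le> 1" for t
    using rt[OF that] that
    by (intro has_derivative_ray F) (simp add: r_def norm_mult mult.commute)
  have "cmod (F (of_real 1 * z) - F (of_real 0 * z)) \<le> \<phi> 1 - \<phi> 0"
  proof (rule differentiable_bound_general[where f = "\<lambda>t. F (of_real t * z)" and \<phi>' = \<phi>'])
    show "continuous_on {0..1} (\<lambda>t. F (of_real t * z))"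
      by (intro continuous_at_imp_continuous_on ballI has_vector_derivative_continuous[OF f]) auto
    show "continuous_on {0..1} \<phi>"
      by (intro continuous_at_imp_continuous_on ballI has_vector_derivative_continuous[OF \<phi>]) auto
    fix t :: real assume t: "0 < t" "t < 1"
    then show "((\<lambda>t. F (of_real t * z)) has_vector_derivative z * h (of_real t * z)) (at t)"
      "(\<phi> has_vector_derivative \<phi>' t) (at t)"
      using f \<phi> by auto
    have n: "cmod (of_real t * z) = r * t" using t by (simp add: norm_mult r_def)
    then show "cmod (z * h (of_real t * z)) \<le> \<phi>' t"
      using h[of "of_real t * z", unfolded n, folded r_def] rt[of t] t r
      by (auto simp: norm_mult r_def[symmetric] \<phi>'_def simp del: norm_of_real intro!: mult_left_mono)
  qed auto
  then show ?thesis
    using divide_nonneg_pos[OF CD s] by (simp add: F0 \<phi>_def r_def)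
qed

text \<open>The sum dominates both constants that arise in \<open>primitive_bound\<close>: 2 / s
  away from the origin and 2 powr (s + 1) near it.\<close>

definition volterra_const :: "real \<Rightarrow> real" where
  "volterra_const s = 2 / s + 2 powr (s + 1)"

lemma volterra_const_ge_1:
  assumes "s > 0" shows "volterra_const s \<ge> 1"
proof -
  have "2 powr 0 \<le> (2::real) powr (s + 1)" using assms by (intro powr_mono) auto
  then show ?thesis using assms by (simp add: volterra_const_def add_increasing)
qed

text \<open>Near the origin the factor \<^term>\<open>cmod z\<close> comes from bounding the integrand by a constant;
  away from the origin it costs a factor 2.\<close>

lemma primitive_bound:
  fixes F :: "complex \<Rightarrow> complex"
  assumes s: "s > 0" and z: "cmod z < 1" and C: "C \<ge> 0" and D: "D \<ge> 0"
    and F: "\<And>\<xi>. cmod \<xi> < 1 \<Longrightarrow> (F has_field_derivative h \<xi>) (at \<xi>)" and F0: "F 0 = 0"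
    and h: "\<And>\<xi>. cmod \<xi> \<le> cmod z \<Longrightarrow> cmod (h \<xi>) \<le> C + D * (1 - cmod \<xi>) powr (- s - 1)"
  shows "cmod (F z) \<le> cmod z * (C + volterra_const s * D * (1 - cmod z) powr (- s))"
proof (cases "cmod z \<le> 1 / 2")
  case True
  \<comment> \<open>The singular term is frozen at its value for radius 1/2, so that
    \<open>primitive_ray_bound\<close> applies with 0 for D and every remaining term carries the
    factor \<open>cmod z\<close>.\<close>
  have "cmod (h \<xi>) \<le> (C + D * 2 powr (s + 1)) + 0 * (1 - cmod \<xi>) powr (- s - 1)"
    if \<xi>: "cmod \<xi> \<le> cmod z" for \<xi>
  proof -
    have "(1 - cmod \<xi>) powr (- s - 1) \<le> (1 / 2) powr (- s - 1)"
      using \<xi> True s by (intro powr_mono2') auto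
    also have "\<dots> = 2 powr (s + 1)" by (simp add: powr_divide powr_minus_divide powr_diff powr_add)
    finally show ?thesis using h[OF \<xi>] D mult_left_mono[OF _ D] by fastforce
  qed
  from primitive_ray_bound[OF s z _ F F0 this]
  have "cmod (F z) \<le> cmod z * (C + 2 powr (s + 1) * D)" by (simp add: algebra_simps)
  also have "\<dots> \<le> cmod z * (C + volterra_const s * D * (1 - cmod z) powr (- s))"
  proof (intro mult_left_mono add_left_mono)
    have "2 powr (s + 1) * D * 1 \<le> volterra_const s * D * (1 - cmod z) powr (- s)"
      using D s weight_inverse_ge_1[OF z, of s]
      by (intro mult_mono) (auto simp: volterra_const_def)
    then show "2 powr (s + 1) * D \<le> volterra_const s * D * (1 - cmod z) powr (- s)" by simp
  qed auto
  finally show ?thesis .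
next
  case False
  have "cmod (F z) \<le> C * cmod z + D / s * (1 - cmod z) powr (- s)"
    by (rule primitive_ray_bound[OF s z D F F0 h])
  also have "D / s * (1 - cmod z) powr (- s) \<le> (2 * cmod z) * (D / s * (1 - cmod z) powr (- s))"
    using False D s mult_right_mono[of 1 "2 * cmod z" "D / s * (1 - cmod z) powr (- s)"] by simp
  also have "(2 * cmod z) * (D / s * (1 - cmod z) powr (- s))
      = cmod z * (2 / s * D * (1 - cmod z) powr (- s))" by simp
  also have "\<dots> \<le> cmod z * (volterra_const s * D * (1 - cmod z) powr (- s))"
    using D s by (intro mult_left_mono mult_right_mono) (auto simp: volterra_const_def)
  finally show ?thesis by (simp add: algebra_simps)
qed

section \<open>Norms of powers and Taylor coefficients\<close>

lemma power_in_growth_space0: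
  assumes "s > 0"
  shows "(\<lambda>z\<in>unit_disc. c * z ^ k) \<in> growth_space0 s"
  unfolding growth_space0_iff[OF assms]
proof (intro conjI allI impI)
  show "(\<lambda>z\<in>unit_disc. c * z ^ k) \<in> hol_disc"
    by (intro restrict_in_hol_disc holomorphic_intros)
  fix \<epsilon> :: real assume "\<epsilon> > 0"
  have "cmod (c * z ^ k) \<le> cmod c + \<epsilon> * (1 - cmod z) powr (- s)" if "cmod z < 1" for z
    using that power_le_one[of "cmod z" k] \<open>\<epsilon> > 0\<close>
      mult_left_mono[of "cmod z ^ k" 1 "cmod c"]
    by (simp add: norm_mult norm_power add_increasing2)
  then show "\<exists>C. \<forall>z\<in>unit_disc. cmod ((\<lambda>z\<in>unit_disc. c * z ^ k) z)
      \<le> C + \<epsilon> * (1 - cmod z) powr (- s)"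
    by (intro exI[of _ "cmod c"]) auto
qed

definition power_norm :: "real \<Rightarrow> nat \<Rightarrow> real" where
  "power_norm s k = growth_norm s (\<lambda>z. z ^ k)"

lemma power_norm_upper:
  assumes "s > 0" "cmod z < 1"
  shows "(1 - cmod z) powr s * cmod z ^ k \<le> power_norm s k"
  unfolding power_norm_def growth_norm_def norm_power
proof (rule cSUP_upper)
  show "bdd_above ((\<lambda>z. (1 - cmod z) powr s * cmod z ^ k) ` unit_disc)"
    using assms(1) by (intro bdd_aboveI2[where M = 1]) (auto intro!: mult_le_one power_le_one powr_le1)
qed (use assms in simp)

lemma power_norm_pos: assumes "s > 0" shows "power_norm s k > 0"
proof -
  have "0 < (1 - cmod (1 / 2)) powr s * cmod (1 / 2) ^ k" by simp
  also have "\<dots> \<le> power_norm s k" using assms by (intro power_norm_upper) auto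
  finally show ?thesis .
qed

lemma power_norm_least:
  assumes "\<And>z. cmod z < 1 \<Longrightarrow> (1 - cmod z) powr s * cmod z ^ k \<le> M"
  shows "power_norm s k \<le> M"
  unfolding power_norm_def growth_norm_def norm_power
  by (rule cSUP_least) (use assms in auto)

text \<open>The norm of the power is bounded below by its weighted value at the midpoint t of r and
  1. Since r / t < 1, the normalised powers decay geometrically, uniformly on the disc of radius
  r.\<close>

lemma power_quotient_le:
  assumes s: "s > 0" and z: "cmod z \<le> r" "r < 1"
  shows "cmod z ^ k / power_norm s k \<le> ((1 - r) / 2) powr (- s) * (2 * r / (1 + r)) ^ k"
proof -
  define t where "t = (1 + r) / 2"
  have r: "0 \<le> r" using z norm_ge_zero order_trans by blast
  have t: "0 < t" "r < t" "t < 1" using z r by (auto simp: t_def)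
  have "0 < (1 - t) powr s * t ^ k" using t by simp
  have "cmod z ^ k / power_norm s k \<le> r ^ k / ((1 - t) powr s * t ^ k)"
    using power_norm_upper[OF s, of "of_real t" k] t z r
    by (intro frac_le power_mono) auto
  also have "\<dots> = (1 - t) powr (- s) * (r / t) ^ k"
    by (simp add: powr_minus power_divide divide_simps)
  also have "1 - t = (1 - r) / 2" by (simp add: t_def field_simps)
  also have "r / t = 2 * r / (1 + r)" by (simp add: t_def)
  finally show ?thesis .
qed

text \<open>Cauchy's inequality on the circle of radius r bounds \<open>cmod (a k)\<close> times the
  weighted k-th power of r by M; the supremum over r turns that factor into the norm of the
  power.\<close>

lemma growth_space_coeff_bound:
  assumes f: "\<And>z. cmod z < 1 \<Longrightarrow> cmod (f z) \<le> M * (1 - cmod z) powr (- s)" 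
    and a: "\<And>z. cmod z < 1 \<Longrightarrow> (\<lambda>k. a k * z ^ k) sums f z"
    and s: "s > 0"
  shows "cmod (a k) * power_norm s k \<le> M"
proof -
  have "f has_fps_expansion Abs_fps a"
  proof (rule has_fps_expansionI)
    have "\<forall>\<^sub>F z in nhds 0. z \<in> unit_disc" by (rule eventually_nhds_in_open) auto
    then show "\<forall>\<^sub>F u in nhds 0. (\<lambda>n. fps_nth (Abs_fps a) n * u ^ n) sums f u"
      by eventually_elim (use a in simp)
  qed
  then have ak: "a k = (deriv ^^ k) f 0 / fact k"
    using fps_nth_fps_expansion[of f "Abs_fps a" k] by simp
  have hol: "f holomorphic_on unit_disc"
    by (rule power_series_holomorphic[where a = a]) (use a in simp)
  have M: "0 \<le> M" using f[of 0] order_trans[OF norm_ge_zero] by fastforce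
  have "cmod (a k) * ((1 - r) powr s * r ^ k) \<le> M" if r: "0 < r" "r < 1" for r
  proof -
    have "cmod ((deriv ^^ k) f 0) \<le> fact k * (M * (1 - r) powr (- s)) / r ^ k"
    proof (rule Cauchy_inequality)
      show "f holomorphic_on ball 0 r"
        by (rule holomorphic_on_subset[OF hol]) (use r in auto)
      show "continuous_on (cball 0 r) f"
        by (rule continuous_on_subset[OF holomorphic_on_imp_continuous_on[OF hol]]) (use r in auto)
    qed (use r f in auto)
    then show ?thesis
      using r by (simp add: ak norm_divide powr_minus field_simps)
  qed note * = this
  have "power_norm s k \<le> M / cmod (a k)" if nz: "a k \<noteq> 0"
  proof (rule power_norm_least)
    fix z :: complex assume z: "cmod z < 1"
    show "(1 - cmod z) powr s * cmod z ^ k \<le> M / cmod (a k)"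
    \<comment> \<open>Cauchy's inequality covers positive radii only. At the origin 0 ^ 0 = 1, so k
      = 0 needs \<open>f 0 = a 0\<close>, while for k > 0 the left side is 0.\<close>
    proof (cases "z = 0")
      case True
      have "cmod (a k) * 0 ^ k \<le> M"
      proof (cases "k = 0")
        case True
        have "(\<lambda>k. a k * 0 ^ k) sums a 0" by (simp add: powser_sums_zero_iff)
        then have "f 0 = a 0" using a[of 0] sums_unique2 by force
        then show ?thesis using f[of 0] True by simp
      qed (use M in \<open>simp add: power_0_left\<close>)
      then show ?thesis using True nz by (simp add: field_simps)
    next
      case False
      then show ?thesis using *[of "cmod z"] z nz by (simp add: field_simps)
    qed
  qed
  then show ?thesis using M by (cases "a k = 0") (auto simp: field_simps)
qed

text \<open>Each property holds at arbitrarily large indices, so dependent choice can always move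
  past the previous index.\<close>

lemma exists_subsequence:
  assumes "\<And>n. \<forall>\<^sub>F k in sequentially. P n k"
  obtains m :: "nat \<Rightarrow> nat" where "strict_mono m" "\<And>n. P n (m n)"
proof -
  have ex: "\<exists>k>l. P n k" for n l
    using eventually_conj[OF assms[of n] eventually_gt_at_top[of l]]
    by (metis (mono_tags, lifting) eventually_sequentially order_refl)
  have "\<exists>m. \<forall>n. P n (m n) \<and> m n < m (Suc n)"
    by (rule dependent_nat_choice) (use ex in blast)+
  then show ?thesis using that by (metis strict_mono_Suc_iff)
qed

section \<open>Compactness of Volterra-type operators\<close>

text \<open>Collects what the two operators share, so that the argument runs once.
  \<open>R_bound\<close> is integration of a majorant: the singular part gains one power of the
  weight at the cost of K, and the constant part passes unchanged. It looks at f only on the closed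
  disc of radius \<open>cmod z\<close>. Non-constancy of g enters through
  \<open>R_inj\<close>.\<close>

locale volterra_operator =
  fixes g :: "complex \<Rightarrow> complex" and s K :: real
    and R :: "(complex \<Rightarrow> complex) \<Rightarrow> complex \<Rightarrow> complex"
  assumes g: "g \<in> little_bloch" and s: "s > 0" and K: "K \<ge> 1"
    and R_hol: "f \<in> hol_disc \<Longrightarrow> R f \<in> hol_disc"
    and R_linear: "f \<in> hol_disc \<Longrightarrow> h \<in> hol_disc \<Longrightarrow> cmod z < 1 \<Longrightarrow>
      R (\<lambda>z\<in>unit_disc. f z + c * h z) z = R f z + c * R h z"
    and R_inj: "inj_on R hol_disc"
    and R_bound: "f \<in> hol_disc \<Longrightarrow> cmod z < 1 \<Longrightarrow> C \<ge> 0 \<Longrightarrow> D \<ge> 0 \<Longrightarrow>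
      (\<And>\<xi>. cmod \<xi> \<le> cmod z \<Longrightarrow>
        cmod (f \<xi> * deriv g \<xi>) \<le> C + D * (1 - cmod \<xi>) powr (- s - 1)) \<Longrightarrow>
      cmod (R f z) \<le> C + K * D * (1 - cmod z) powr (- s)"
begin

lemma deriv_g_holomorphic: "deriv g holomorphic_on unit_disc"
  using g by (intro holomorphic_deriv) (auto simp: little_bloch_def bloch_def hol_disc_iff)

lemma deriv_g_vanishing: "((\<lambda>z. (1 - cmod z) powr 1 * cmod (deriv g z)) \<longlongrightarrow> 0) to_circle"
proof (rule Lim_transform_eventually)
  show "((\<lambda>z. (1 - cmod z) * cmod (deriv g z)) \<longlongrightarrow> 0) to_circle"
    using g by (simp add: little_bloch_def)
  show "\<forall>\<^sub>F z in to_circle.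
      (1 - cmod z) * cmod (deriv g z) = (1 - cmod z) powr 1 * cmod (deriv g z)"
    unfolding eventually_to_circle by (intro exI[of _ 0]) auto
qed

lemma deriv_g_split:
  assumes "\<epsilon> > 0"
  obtains C where "C \<ge> 0"
    "\<And>z. cmod z < 1 \<Longrightarrow> cmod (deriv g z) \<le> C + \<epsilon> * (1 - cmod z) powr (- 1)"
proof -
  obtain C where "C \<ge> 0"
    "\<And>z. z \<in> unit_disc \<Longrightarrow> cmod (deriv g z) \<le> C + \<epsilon> * (1 - cmod z) powr (- 1)"
    using vanishing_imp_split[OF holomorphic_on_imp_continuous_on[OF deriv_g_holomorphic]
        deriv_g_vanishing assms] by blast
  then show ?thesis using that by simp
qed

text \<open>This is where \<^term>\<open>g\<close> being in the little Bloch space acts as compactness: a function that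
  is bounded in \<^term>\<open>growth_space s\<close> and small on a compact disc has a small integrand. Near the
  circle the bounded part of \<^term>\<open>deriv g\<close> costs one power of the weight less than the rest.\<close>

lemma integrand_bound:
  assumes Q: "Q \<ge> 0" and e: "\<epsilon> > 0"
  obtains B r where "B \<ge> 0" "0 < r" "r < 1"
    "\<And>f d \<xi>. cmod \<xi> < 1 \<Longrightarrow> d \<ge> 0 \<Longrightarrow> cmod (f \<xi>) \<le> Q * (1 - cmod \<xi>) powr (- s) \<Longrightarrow>
       (cmod \<xi> \<le> r \<Longrightarrow> cmod (f \<xi>) \<le> d) \<Longrightarrow>
       cmod (f \<xi> * deriv g \<xi>) \<le> B * d + \<epsilon> * (1 - cmod \<xi>) powr (- s - 1)"
proof -
  \<comment> \<open>Two error terms of size \<open>\<eta> * Q\<close> will arise, one from each part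
    of the bound on \<open>deriv g\<close>; together they stay below \<open>\<epsilon>\<close>. The
    added 1 covers Q = 0.\<close>
  define \<eta> where "\<eta> = \<epsilon> / (2 * (Q + 1))"
  have \<eta>: "\<eta> > 0" using Q e by (simp add: \<eta>_def)
  obtain B where B: "B \<ge> 0"
    "\<And>z. cmod z < 1 \<Longrightarrow> cmod (deriv g z) \<le> B + \<eta> * (1 - cmod z) powr (- 1)"
    using deriv_g_split[OF \<eta>] by blast
  \<comment> \<open>Beyond this radius B times the weight is at most \<open>\<eta>\<close>, so the
    bounded part of \<open>deriv g\<close> is negligible too. The maximum keeps r positive.\<close>
  define r where "r = max (1 / 2) (1 - \<eta> / (B + 1))"
  have r: "0 < r" "r < 1" using \<eta> B(1) by (auto simp: r_def)
  have Br: "B * (1 - x) \<le> \<eta>" if "r < x" "x < 1" for x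
  proof -
    have "1 - x \<le> \<eta> / (B + 1)" using that by (simp add: r_def)
    then have "(B + 1) * (1 - x) \<le> \<eta>" using B(1) by (simp add: field_simps)
    moreover have "B * (1 - x) \<le> (B + 1) * (1 - x)" using that by (intro mult_right_mono) auto
    ultimately show ?thesis by simp
  qed
  have Qe: "Q * (2 * \<eta>) \<le> \<epsilon>" using Q e by (simp add: \<eta>_def field_simps)
  show ?thesis
  \<comment> \<open>B and r are fixed before f, which makes the estimate uniform over a whole
    sequence in \<open>R_locally_uniformly_null\<close>.\<close>
  proof (rule that[OF B(1) r])
    fix f :: "complex \<Rightarrow> complex" and d \<xi>
    assume \<xi>: "cmod \<xi> < 1" and d: "d \<ge> 0" and f: "cmod (f \<xi>) \<le> Q * (1 - cmod \<xi>) powr (- s)"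
      and fd: "cmod \<xi> \<le> r \<Longrightarrow> cmod (f \<xi>) \<le> d"
    define w where "w = 1 - cmod \<xi>"
    have w: "w > 0" using \<xi> by (simp add: w_def)
    have ws: "w powr (- s) * w powr (- 1) = w powr (- s - 1)"
      using powr_add[of w "- s" "- 1"] by simp
    have ws': "w powr (- s) = w * w powr (- s - 1)"
      using w by (simp add: powr_diff)
    have "cmod (f \<xi> * deriv g \<xi>) \<le> cmod (f \<xi>) * (B + \<eta> * w powr (- 1))"
      unfolding norm_mult w_def by (intro mult_left_mono B \<xi>) auto
    also have "\<dots> = B * cmod (f \<xi>) + \<eta> * (cmod (f \<xi>) * w powr (- 1))" by (simp add: algebra_simps)
    also have "\<dots> \<le> B * cmod (f \<xi>) + \<eta> * (Q * w powr (- s) * w powr (- 1))"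
      using f \<eta> by (intro add_left_mono mult_left_mono mult_right_mono) (auto simp: w_def)
    also have "\<dots> = B * cmod (f \<xi>) + \<eta> * Q * w powr (- s - 1)" by (simp only: mult.assoc ws)
    finally have 1: "cmod (f \<xi> * deriv g \<xi>) \<le> B * cmod (f \<xi>) + \<eta> * Q * w powr (- s - 1)" .
    have 2: "B * cmod (f \<xi>) \<le> B * d + \<eta> * Q * w powr (- s - 1)"
    proof (cases "cmod \<xi> \<le> r")
      case True
      then show ?thesis using mult_left_mono[OF fd B(1)] \<eta> Q by (simp add: add_increasing2)
    next
      case False
      have "B * cmod (f \<xi>) \<le> B * (Q * w powr (- s))"
        using f B(1) by (intro mult_left_mono) (auto simp: w_def)
      also have "\<dots> = (B * w) * (Q * w powr (- s - 1))" by (subst ws') simp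
      also have "\<dots> \<le> \<eta> * (Q * w powr (- s - 1))"
        using Br[of "cmod \<xi>"] False \<xi> Q by (intro mult_right_mono) (auto simp: w_def)
      finally show ?thesis using B(1) d by (simp add: add_increasing mult.assoc)
    qed
    have "cmod (f \<xi> * deriv g \<xi>) \<le> B * d + Q * (2 * \<eta>) * w powr (- s - 1)"
      using 1 2 by (simp add: algebra_simps)
    also have "\<dots> \<le> B * d + \<epsilon> * w powr (- s - 1)"
      using Qe by (intro add_left_mono mult_right_mono) auto
    finally show "cmod (f \<xi> * deriv g \<xi>) \<le> B * d + \<epsilon> * (1 - cmod \<xi>) powr (- s - 1)"
      by (simp add: w_def)
  qed
qed

text \<open>By \<open>integrand_bound\<close>, with d a bound for f on the disc of radius r, the
  singular part of the integrand is arbitrarily small, and \<open>R_bound\<close> carries this over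
  to R f. Landing in the smaller space is what allows one argument for both spaces.\<close>

lemma R_growth_space:
  assumes "f \<in> growth_space s"
  shows "R f \<in> growth_space0 s"
  unfolding growth_space0_iff[OF s]
proof (intro conjI allI impI)
  have f: "f \<in> hol_disc" using assms by (simp add: growth_space_iff)
  then show "R f \<in> hol_disc" by (rule R_hol)
  obtain M where M: "\<And>z. cmod z < 1 \<Longrightarrow> cmod (f z) \<le> M * (1 - cmod z) powr (- s)"
    using assms unfolding growth_space_iff by (metis mem_ball_0)
  have M0: "M \<ge> 0" using M[of 0] order_trans[OF norm_ge_zero] by fastforce
  fix \<epsilon> :: real assume e: "\<epsilon> > 0"
  \<comment> \<open>Division by K anticipates the factor K of \<open>R_bound\<close>.\<close>
  have eK: "\<epsilon> / K > 0" using e K by simp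
  obtain B r where B: "B \<ge> 0" "0 < r" "r < 1"
    and Bb: "\<And>f d \<xi>. cmod \<xi> < 1 \<Longrightarrow> d \<ge> 0 \<Longrightarrow> cmod (f \<xi>) \<le> M * (1 - cmod \<xi>) powr (- s) \<Longrightarrow>
       (cmod \<xi> \<le> r \<Longrightarrow> cmod (f \<xi>) \<le> d) \<Longrightarrow>
       cmod (f \<xi> * deriv g \<xi>) \<le> B * d + \<epsilon> / K * (1 - cmod \<xi>) powr (- s - 1)"
    using integrand_bound[OF M0 eK] by blast
  define d where "d = M * (1 - r) powr (- s)"
  have d: "d \<ge> 0" using M0 by (simp add: d_def)
  have fd: "cmod (f \<xi>) \<le> d" if "cmod \<xi> \<le> r" for \<xi>
  proof -
    have "(1 - cmod \<xi>) powr (- s) \<le> (1 - r) powr (- s)"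
      using that B s by (intro powr_mono2') auto
    from mult_left_mono[OF this M0] M[of \<xi>] that B show ?thesis by (simp add: d_def)
  qed
  have "cmod (R f z) \<le> B * d + K * (\<epsilon> / K) * (1 - cmod z) powr (- s)" if "cmod z < 1" for z
    using that B(1) d e K M Bb[OF _ d] fd by (intro R_bound f) auto
  then show "\<exists>C. \<forall>z\<in>unit_disc. cmod (R f z) \<le> C + \<epsilon> * (1 - cmod z) powr (- s)"
    using K by (intro exI[of _ "B * d"]) auto
qed

text \<open>Compactness in sequential form: local uniform convergence makes the constant term B * d
  small, the little Bloch condition handles the rest. The constant is absorbed because the inverse
  weight is at least 1.\<close>

lemma R_locally_uniformly_null:
  assumes f: "\<And>k. f k \<in> hol_disc"
    and f_le: "\<And>k z. cmod z < 1 \<Longrightarrow> cmod (f k z) \<le> (1 - cmod z) powr (- s)"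
    and lim: "\<And>r. 0 < r \<Longrightarrow> r < 1 \<Longrightarrow> uniform_limit (cball 0 r) f (\<lambda>_. 0) sequentially"
    and e: "e > 0"
  shows "\<forall>\<^sub>F k in sequentially. \<forall>z. cmod z < 1 \<longrightarrow> cmod (R (f k) z) \<le> e * (1 - cmod z) powr (- s)"
proof -
  have eK: "e / (2 * K) > 0" using e K by simp
  obtain B r where B: "B \<ge> 0" "0 < r" "r < 1"
    and Bb: "\<And>f d \<xi>. cmod \<xi> < 1 \<Longrightarrow> d \<ge> 0 \<Longrightarrow> cmod (f \<xi>) \<le> 1 * (1 - cmod \<xi>) powr (- s) \<Longrightarrow>
       (cmod \<xi> \<le> r \<Longrightarrow> cmod (f \<xi>) \<le> d) \<Longrightarrow>
       cmod (f \<xi> * deriv g \<xi>) \<le> B * d + e / (2 * K) * (1 - cmod \<xi>) powr (- s - 1)"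
    using integrand_bound[OF zero_le_one eK] by blast
  define d where "d = e / (2 * (B + 1))"
  have d: "d > 0" using e B by (simp add: d_def)
  have Bd: "B * d \<le> e / 2" "B * d \<ge> 0" using e B by (simp_all add: d_def field_simps)
  have "\<forall>\<^sub>F k in sequentially. \<forall>\<xi>\<in>cball 0 r. dist (f k \<xi>) 0 < d"
    using uniform_limitD[OF lim[OF B(2,3)] d] .
  then show ?thesis
  proof eventually_elim
    case (elim k)
    show ?case
    proof (intro allI impI)
      fix z :: complex assume z: "cmod z < 1"
      have fb: "cmod (f k \<xi> * deriv g \<xi>) \<le> B * d + e / (2 * K) * (1 - cmod \<xi>) powr (- s - 1)"
        if "cmod \<xi> < 1" for \<xi>
        using that d elim f_le by (intro Bb) (auto simp: less_imp_le)
      have "cmod (R (f k) z) \<le> B * d + K * (e / (2 * K)) * (1 - cmod z) powr (- s)"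
        using z fb Bd e K by (intro R_bound f) auto
      also have "\<dots> \<le> e / 2 * (1 - cmod z) powr (- s) + e / 2 * (1 - cmod z) powr (- s)"
      proof (intro add_mono)
        have "e / 2 * 1 \<le> e / 2 * (1 - cmod z) powr (- s)"
          using s e by (intro mult_left_mono weight_inverse_ge_1 z) auto
        then show "B * d \<le> e / 2 * (1 - cmod z) powr (- s)" using Bd(1) by linarith
      qed (use K in simp)
      finally show "cmod (R (f k) z) \<le> e * (1 - cmod z) powr (- s)" by simp
    qed
  qed
qed

definition unit_power :: "nat \<Rightarrow> complex \<Rightarrow> complex" where
  "unit_power k = (\<lambda>z\<in>unit_disc. 1 / of_real (power_norm s k) * z ^ k)"

lemma unit_power_growth_space0: "unit_power k \<in> growth_space0 s"
  unfolding unit_power_def by (rule power_in_growth_space0[OF s])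

lemma unit_power_hol_disc: "unit_power k \<in> hol_disc"
  using unit_power_growth_space0 by (simp add: growth_space0_def)

lemma cmod_unit_power:
  "cmod z < 1 \<Longrightarrow> cmod (unit_power k z) = cmod z ^ k / power_norm s k"
  using power_norm_pos[OF s, of k] by (simp add: unit_power_def norm_divide norm_mult norm_power)

lemma unit_power_le:
  assumes "cmod z \<le> r" "r < 1"
  shows "cmod (unit_power k z) \<le> ((1 - r) / 2) powr (- s) * (2 * r / (1 + r)) ^ k"
  using power_quotient_le[OF s assms] assms by (simp add: cmod_unit_power)

lemma R_unit_power_null:
  assumes "e > 0"
  shows "\<forall>\<^sub>F k in sequentially.
    \<forall>z. cmod z < 1 \<longrightarrow> cmod (R (unit_power k) z) \<le> e * (1 - cmod z) powr (- s)"
proof (rule R_locally_uniformly_null[OF unit_power_hol_disc _ _ assms])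
  fix k z assume z: "cmod z < 1"
  show "cmod (unit_power k z) \<le> (1 - cmod z) powr (- s)"
    using weight_mult_le_iff[OF z, of s "cmod (unit_power k z)" 1] power_norm_upper[OF s z, of k]
      power_norm_pos[OF s, of k] by (simp add: cmod_unit_power z)
next
  fix r :: real assume r: "0 < r" "r < 1"
  show "uniform_limit (cball 0 r) unit_power (\<lambda>_. 0) sequentially"
  proof (rule uniform_limitI)
    fix d :: real assume d: "d > 0"
    have "(\<lambda>k. ((1 - r) / 2) powr (- s) * (2 * r / (1 + r)) ^ k)
        \<longlonglongrightarrow> ((1 - r) / 2) powr (- s) * 0"
      using r by (intro tendsto_mult_left LIMSEQ_power_zero) (auto simp: field_simps)
    then have "\<forall>\<^sub>F k in sequentially. ((1 - r) / 2) powr (- s) * (2 * r / (1 + r)) ^ k < d"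
      using d by (intro order_tendstoD(2)) auto
    then show "\<forall>\<^sub>F k in sequentially. \<forall>z\<in>cball 0 r. dist (unit_power k z) 0 < d"
      by eventually_elim (auto intro: le_less_trans[OF unit_power_le[OF _ r(2)]])
  qed
qed

end

section \<open>The lacunary witness and its consequences\<close>

lemma growth_space0_add_scaled:
  assumes "f \<in> growth_space0 s" "h \<in> growth_space0 s"
  shows "(\<lambda>z\<in>unit_disc. f z + c * h z) \<in> growth_space0 s"
proof -
  have hol: "(\<lambda>z\<in>unit_disc. f z + c * h z) \<in> hol_disc"
    using assms by (intro restrict_in_hol_disc holomorphic_intros)
      (auto simp: growth_space0_def hol_disc_iff)
  have "((\<lambda>z. (1 - cmod z) powr s * cmod (f z) + cmod c * ((1 - cmod z) powr s * cmod (h z)))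
      \<longlongrightarrow> 0 + cmod c * 0) to_circle"
    using assms by (intro tendsto_intros) (auto simp: growth_space0_def)
  then have lim: "((\<lambda>z. (1 - cmod z) powr s * cmod (f z)
      + cmod c * ((1 - cmod z) powr s * cmod (h z))) \<longlongrightarrow> 0) to_circle" by simp
  have "\<forall>\<^sub>F z in to_circle.
      norm ((1 - cmod z) powr s * cmod ((\<lambda>z\<in>unit_disc. f z + c * h z) z))
      \<le> (1 - cmod z) powr s * cmod (f z) + cmod c * ((1 - cmod z) powr s * cmod (h z))"
    unfolding eventually_to_circle
  proof (intro exI[of _ 0] conjI allI impI)
    fix z :: complex assume "cmod z < 1"
    moreover have "(1 - cmod z) powr s * cmod (f z + c * h z)
        \<le> (1 - cmod z) powr s * (cmod (f z) + cmod c * cmod (h z))"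
      using norm_triangle_ineq[of "f z" "c * h z"] by (intro mult_left_mono) (auto simp: norm_mult)
    ultimately show "norm ((1 - cmod z) powr s * cmod ((\<lambda>z\<in>unit_disc. f z + c * h z) z))
      \<le> (1 - cmod z) powr s * cmod (f z) + cmod c * ((1 - cmod z) powr s * cmod (h z))"
      by (simp add: algebra_simps)
  qed simp
  from hol Lim_null_comparison[OF this lim] show ?thesis by (simp add: growth_space0_def)
qed

lemma growth_dist_le:
  assumes "f \<in> growth_space s" "h \<in> growth_space s"
    and "\<And>z. cmod z < 1 \<Longrightarrow> cmod (f z - h z) \<le> M * (1 - cmod z) powr (- s)"
  shows "growth_dist s f h \<le> M"
proof -
  have "growth_norm s (\<lambda>z. f z - h z) \<le> M"
    unfolding growth_norm_def
    by (rule cSUP_least) (use assms(3) in \<open>auto simp: weight_mult_le_iff\<close>)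
  then show ?thesis using assms by (simp add: growth_dist_def)
qed

lemma Metric_space_growth_subset:
  "X \<subseteq> growth_space s \<Longrightarrow> Metric_space X (growth_dist s)"
  by (rule Metric_space.subspace[OF Metric_space_growth_space])

context volterra_operator
begin

lemma R_zero:
  assumes "cmod z < 1"
  shows "R (\<lambda>z\<in>unit_disc. 0) z = 0"
proof -
  have "cmod (R (\<lambda>z\<in>unit_disc. 0) z) \<le> 0 + K * 0 * (1 - cmod z) powr (- s)"
    using assms by (intro R_bound restrict_in_hol_disc holomorphic_intros) auto
  then show ?thesis by simp
qed

text \<open>On the closed disc of radius \<open>cmod z\<close> the derivative of g is bounded, so a
  uniformly small difference has a uniformly small integrand; \<open>R_bound\<close> then applies
  with D = 0.\<close>

lemma R_tendsto:
  assumes f: "f \<in> hol_disc" and \<sigma>: "\<And>n. \<sigma> n \<in> hol_disc"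
    and lim: "\<And>r. r < 1 \<Longrightarrow> uniform_limit (cball 0 r) \<sigma> f sequentially"
    and z: "cmod z < 1"
  shows "(\<lambda>n. R (\<sigma> n) z) \<longlonglongrightarrow> R f z"
proof (rule tendstoI)
  fix e :: real assume e: "e > 0"
  have "continuous_on (cball 0 (cmod z)) (deriv g)"
    by (rule continuous_on_subset[OF holomorphic_on_imp_continuous_on[OF deriv_g_holomorphic]])
      (use z in auto)
  then have "bounded (deriv g ` cball 0 (cmod z))"
    by (intro compact_imp_bounded compact_continuous_image) auto
  then obtain B where B: "B > 0" "\<And>\<xi>. cmod \<xi> \<le> cmod z \<Longrightarrow> cmod (deriv g \<xi>) \<le> B"
    unfolding bounded_pos by auto
  have "\<forall>\<^sub>F n in sequentially. \<forall>\<xi>\<in>cball 0 (cmod z). dist (\<sigma> n \<xi>) (f \<xi>) < e / (2 * B)"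
    using e B by (intro uniform_limitD[OF lim[OF z]]) simp
  then show "\<forall>\<^sub>F n in sequentially. dist (R (\<sigma> n) z) (R f z) < e"
  proof eventually_elim
    case (elim n)
    let ?d = "\<lambda>\<xi>\<in>unit_disc. \<sigma> n \<xi> + (- 1) * f \<xi>"
    have "cmod (R ?d z) \<le> e / 2 + K * 0 * (1 - cmod z) powr (- s)"
    proof (rule R_bound)
      show "?d \<in> hol_disc"
        using f \<sigma>[of n] by (intro restrict_in_hol_disc holomorphic_intros) (auto simp: hol_disc_iff)
      fix \<xi> assume \<xi>: "cmod \<xi> \<le> cmod z"
      have "cmod (?d \<xi> * deriv g \<xi>) = cmod (\<sigma> n \<xi> - f \<xi>) * cmod (deriv g \<xi>)"
        using \<xi> z by (simp add: norm_mult)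
      also have "\<dots> \<le> e / (2 * B) * B"
        using elim \<xi> B e by (intro mult_mono) (auto simp: dist_norm less_imp_le)
      finally show "cmod (?d \<xi> * deriv g \<xi>) \<le> e / 2 + 0 * (1 - cmod \<xi>) powr (- s - 1)"
        using B by simp
    qed (use z e in auto)
    moreover have "R ?d z = R (\<sigma> n) z - R f z"
      using R_linear[OF \<sigma> f z, of n "- 1"] by simp
    ultimately show ?case using e by (simp add: dist_norm)
  qed
qed

text \<open>Supplies the common witness for both conclusions. Norm continuity of R says nothing
  about f, which lies outside the space; R f is identified as the limit pointwise, by
  \<open>R_tendsto\<close>.\<close>

lemma exists_unbounded_with_small_image:
  obtains f \<sigma> where "f \<in> hol_disc" "f \<notin> growth_space s" "R f \<in> growth_space0 s"
    "\<forall>n::nat. \<sigma> n \<in> growth_space0 s"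
    "\<forall>n z. cmod z < 1 \<longrightarrow> cmod (R (\<sigma> n) z - R f z) \<le> 2 * (1 / 2) ^ n * (1 - cmod z) powr (- s)"
proof -
  \<comment> \<open>Dividing by \<open>Suc n\<close> cancels the coefficient of the n-th term,
    leaving the summable bound (1 / 2) ^ n.\<close>
  define P where "P = (\<lambda>n k. \<forall>z. cmod z < 1 \<longrightarrow>
    cmod (R (unit_power k) z) \<le> (1 / 2) ^ n / real (Suc n) * (1 - cmod z) powr (- s))"
  have P: "\<forall>\<^sub>F k in sequentially. P n k" for n
    unfolding P_def by (rule R_unit_power_null) simp
  obtain m :: "nat \<Rightarrow> nat" where m: "strict_mono m" "\<And>n. P n (m n)"
    using exists_subsequence[of P, OF P] by metis
  define p where "p = (\<lambda>n z. of_nat (Suc n) * unit_power (m n) z)"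
  define f where "f = (\<lambda>z\<in>unit_disc. \<Sum>n. p n z)"
  define \<sigma> where "\<sigma> = (\<lambda>N. \<lambda>z\<in>unit_disc. \<Sum>n<N. p n z)"
  \<comment> \<open>The Taylor coefficients of f: \<open>inv m\<close> recovers the index n from the
    exponent, and exponents in the gaps get 0.\<close>
  define a where "a = (\<lambda>k. if k \<in> range m then of_nat (Suc (inv m k)) / of_real (power_norm s k)
                      else (0 :: complex))"
  have inj_m: "inj m" using m(1) by (rule strict_mono_imp_inj_on)
  have a_m: "a (m n) = of_nat (Suc n) / of_real (power_norm s (m n))" for n
    using inj_m by (simp add: a_def)
  have p_eq: "p n z = a (m n) * z ^ m n" if "cmod z < 1" for n z
    using that by (simp add: p_def a_m unit_power_def)
  have dom: "\<exists>M. summable M \<and> (\<forall>n z. cmod z \<le> r \<longrightarrow> cmod (p n z) \<le> M n)" if r: "0 \<le> r" "r < 1" for r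
  proof -
    define q where "q = 2 * r / (1 + r)"
    have q: "0 \<le> q" "q < 1" using r by (auto simp: q_def field_simps)
    define M where "M = (\<lambda>n. ((1 - r) / 2) powr (- s) * (real (Suc n) * q ^ n))"
    have "summable M"
      unfolding M_def using geometric_deriv_sums[of q] q
      by (intro summable_mult) (auto simp: sums_iff)
    moreover have "cmod (p n z) \<le> M n" if z: "cmod z \<le> r" for n z
    proof -
      \<comment> \<open>Since \<open>n \<le> m n\<close>, the terms are dominated by those of the
        differentiated geometric series.\<close>
      have "q ^ m n \<le> q ^ n"
        using q strict_mono_imp_increasing[OF m(1)] by (intro power_decreasing) auto
      then have "cmod (unit_power (m n) z) \<le> ((1 - r) / 2) powr (- s) * q ^ n"
        using order_trans[OF unit_power_le[OF z r(2)] mult_left_mono] by (simp add: q_def)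
      from mult_left_mono[OF this, of "real (Suc n)"] show ?thesis
        by (simp add: p_def M_def norm_mult mult_ac del: of_nat_Suc)
    qed
    ultimately show ?thesis by blast
  qed
  have unif: "uniform_limit (cball 0 r) \<sigma> f sequentially" if r: "r < 1" for r
  \<comment> \<open>For negative r the disc is empty.\<close>
  proof (cases "r \<ge> 0")
    case True
    obtain M where M: "summable M" "\<And>n z. cmod z \<le> r \<Longrightarrow> cmod (p n z) \<le> M n"
      using dom[OF True r] by blast
    have "uniform_limit (cball 0 r) (\<lambda>N z. \<Sum>n<N. p n z) (\<lambda>z. \<Sum>n. p n z) sequentially"
      by (rule Weierstrass_m_test[OF _ M(1)]) (use M(2) in auto)
    moreover have "uniform_limit (cball 0 r) \<sigma> f sequentially \<longleftrightarrow>
        uniform_limit (cball 0 r) (\<lambda>N z. \<Sum>n<N. p n z) (\<lambda>z. \<Sum>n. p n z) sequentially"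
      by (rule uniform_limit_cong') (use r in \<open>auto simp: \<sigma>_def f_def\<close>)
    ultimately show ?thesis by blast
  qed auto
  have f_sums: "(\<lambda>n. p n z) sums f z" if z: "cmod z < 1" for z
  proof -
    obtain M where "summable M" "\<And>n. cmod (p n z) \<le> M n"
      using dom[of "cmod z"] z by auto
    then have "summable (\<lambda>n. p n z)" by (rule summable_comparison_test'[where N = 0])
    then show ?thesis using z by (simp add: f_def summable_sums)
  qed
  have a_sums: "(\<lambda>k. a k * z ^ k) sums f z" if z: "cmod z < 1" for z
    using sums_mono_reindex[OF m(1), of "\<lambda>k. a k * z ^ k" "f z"] f_sums[OF z] p_eq[OF z]
    by (simp add: a_def)
  have "f holomorphic_on unit_disc"
    by (rule power_series_holomorphic[where a = a]) (use a_sums in simp)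
  then have f: "f \<in> hol_disc" by (simp add: hol_disc_iff f_def)
  have f_unbounded: "f \<notin> growth_space s"
  proof
    assume "f \<in> growth_space s"
    then obtain M where M: "\<And>z. cmod z < 1 \<Longrightarrow> cmod (f z) \<le> M * (1 - cmod z) powr (- s)"
      unfolding growth_space_iff by (metis mem_ball_0)
    \<comment> \<open>The coefficient at exponent \<open>m n\<close> times the norm of that power is
      exactly n + 1, so no M can bound them all.\<close>
    have *: "real (Suc n) \<le> M" for n
      using growth_space_coeff_bound[OF M a_sums s, of "m n"] power_norm_pos[OF s, of "m n"]
      by (simp add: a_m norm_divide del: of_nat_Suc)
    obtain n where "M < real n" using reals_Archimedean2 by blast
    then show False using *[of n] by simp
  qed
  have \<sigma>_Suc: "\<sigma> (Suc N) = (\<lambda>z\<in>unit_disc. \<sigma> N z + of_nat (Suc N) * unit_power (m N) z)" for N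
    by (rule ext) (simp add: \<sigma>_def p_def del: of_nat_Suc)
  have \<sigma>: "\<sigma> N \<in> growth_space0 s" for N
  proof (induction N)
    case 0
    have "\<sigma> 0 = (\<lambda>z\<in>unit_disc. 0 * z ^ 0)" by (rule ext) (simp add: \<sigma>_def)
    then show ?case using power_in_growth_space0[OF s, of 0 0] by (simp only:)
  next
    case (Suc N)
    then show ?case
      unfolding \<sigma>_Suc by (intro growth_space0_add_scaled unit_power_growth_space0)
  qed
  then have \<sigma>_hol: "\<sigma> N \<in> hol_disc" for N by (simp add: growth_space0_def)
  have step: "cmod (R (\<sigma> (Suc N)) z - R (\<sigma> N) z) \<le> (1 / 2) ^ N * (1 - cmod z) powr (- s)"
    if z: "cmod z < 1" for N z
  proof -
    have "R (\<sigma> (Suc N)) z - R (\<sigma> N) z = of_nat (Suc N) * R (unit_power (m N)) z"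
      unfolding \<sigma>_Suc using R_linear[OF \<sigma>_hol unit_power_hol_disc z] by simp
    then have "cmod (R (\<sigma> (Suc N)) z - R (\<sigma> N) z) = real (Suc N) * cmod (R (unit_power (m N)) z)"
      by (simp add: norm_mult del: of_nat_Suc)
    also have "\<dots> \<le> real (Suc N) * ((1 / 2) ^ N / real (Suc N) * (1 - cmod z) powr (- s))"
    proof (rule mult_left_mono)
      show "cmod (R (unit_power (m N)) z) \<le> (1 / 2) ^ N / real (Suc N) * (1 - cmod z) powr (- s)"
        using m(2)[of N] z by (simp add: P_def del: of_nat_Suc)
    qed simp
    finally show ?thesis by simp
  qed
  \<comment> \<open>The factor is the exact finite geometric sum; the subtracted term makes the
    induction close.\<close>
  have tail: "cmod (R (\<sigma> (N + j)) z - R (\<sigma> N) z)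
      \<le> 2 * ((1 / 2) ^ N - (1 / 2) ^ (N + j)) * (1 - cmod z) powr (- s)"
    if z: "cmod z < 1" for N j z
  proof (induction j)
    case (Suc j)
    have "cmod (R (\<sigma> (N + Suc j)) z - R (\<sigma> N) z)
        \<le> cmod (R (\<sigma> (Suc (N + j))) z - R (\<sigma> (N + j)) z) + cmod (R (\<sigma> (N + j)) z - R (\<sigma> N) z)"
      using norm_triangle_ineq[of "R (\<sigma> (Suc (N + j))) z - R (\<sigma> (N + j)) z"
        "R (\<sigma> (N + j)) z - R (\<sigma> N) z"] by simp
    also have "\<dots> \<le> (1 / 2) ^ (N + j) * (1 - cmod z) powr (- s)
        + 2 * ((1 / 2) ^ N - (1 / 2) ^ (N + j)) * (1 - cmod z) powr (- s)"
      by (intro add_mono step z Suc)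
    also have "\<dots> = 2 * ((1 / 2) ^ N - (1 / 2) ^ (N + Suc j)) * (1 - cmod z) powr (- s)"
      by (simp add: algebra_simps)
    finally show ?case .
  qed simp
  have close: "cmod (R (\<sigma> N) z - R f z) \<le> 2 * (1 / 2) ^ N * (1 - cmod z) powr (- s)"
    if z: "cmod z < 1" for N z
  proof (rule Lim_bounded)
    show "(\<lambda>n. cmod (R (\<sigma> N) z - R (\<sigma> n) z)) \<longlonglongrightarrow> cmod (R (\<sigma> N) z - R f z)"
      by (intro tendsto_intros R_tendsto f \<sigma>_hol unif z)
    show "\<forall>n\<ge>N. cmod (R (\<sigma> N) z - R (\<sigma> n) z) \<le> 2 * (1 / 2) ^ N * (1 - cmod z) powr (- s)"
    proof (intro allI impI)
      fix n assume "N \<le> n"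
      then obtain j where j: "n = N + j" using le_Suc_ex by blast
      have "2 * ((1 / 2) ^ N - (1 / 2) ^ (N + j)) * (1 - cmod z) powr (- s)
          \<le> 2 * (1 / 2) ^ N * (1 - cmod z) powr (- s)" by (intro mult_right_mono) auto
      with tail[OF z, of N j]
      show "cmod (R (\<sigma> N) z - R (\<sigma> n) z) \<le> 2 * (1 / 2) ^ N * (1 - cmod z) powr (- s)"
        by (simp add: j norm_minus_commute)
    qed
  qed
  have "R f \<in> growth_space0 s"
    unfolding growth_space0_iff[OF s]
  proof (intro conjI allI impI R_hol f)
    fix \<epsilon> :: real assume e: "\<epsilon> > 0"
    \<comment> \<open>Then \<open>2 * (1 / 2) ^ N\<close> is below \<open>\<epsilon> / 2\<close>,
      and the other half is spent on the image of the partial sum.\<close>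
    obtain N where N: "(1 / 2) ^ N < \<epsilon> / 4"
      using real_arch_pow_inv[of "\<epsilon> / 4" "1 / 2"] e by auto
    have "R (\<sigma> N) \<in> growth_space0 s" using R_growth_space \<sigma> growth_space0_subset by blast
    then obtain C
      where "\<forall>z\<in>unit_disc. cmod (R (\<sigma> N) z) \<le> C + \<epsilon> / 2 * (1 - cmod z) powr (- s)"
      unfolding growth_space0_iff[OF s] using half_gt_zero[OF e] by blast
    then have C: "cmod (R (\<sigma> N) z) \<le> C + \<epsilon> / 2 * (1 - cmod z) powr (- s)" if "cmod z < 1" for z
      using that by simp
    have "cmod (R f z) \<le> C + \<epsilon> * (1 - cmod z) powr (- s)" if z: "cmod z < 1" for z
    proof -
      have "cmod (R f z) \<le> cmod (R (\<sigma> N) z) + cmod (R (\<sigma> N) z - R f z)"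
        using norm_triangle_sub[of "R f z" "R (\<sigma> N) z"] by (simp add: norm_minus_commute)
      also have "\<dots> \<le> (C + \<epsilon> / 2 * (1 - cmod z) powr (- s)) + 2 * (1 / 2) ^ N * (1 - cmod z) powr (- s)"
        by (intro add_mono C close z)
      also have "\<dots> \<le> (C + \<epsilon> / 2 * (1 - cmod z) powr (- s)) + \<epsilon> / 2 * (1 - cmod z) powr (- s)"
        using N by (intro add_left_mono mult_right_mono) auto
      finally show ?thesis by simp
    qed
    then show "\<exists>C. \<forall>z\<in>unit_disc. cmod (R f z) \<le> C + \<epsilon> * (1 - cmod z) powr (- s)"
      by (intro exI[of _ C]) auto
  qed
  then show ?thesis using that[OF f f_unbounded, of \<sigma>] \<sigma> close by simp
qed

text \<open>R f is a norm limit of images of the partial sums. A preimage of R f in X would equal f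
  by injectivity on all of \<open>hol_disc\<close>, although f lies outside X.\<close>

lemma not_has_closed_range:
  assumes X: "growth_space0 s \<subseteq> X" "X \<subseteq> growth_space s"
  shows "\<not> has_closed_range s X R"
proof
  assume "has_closed_range s X R"
  interpret Metric_space X "growth_dist s" using X(2) by (rule Metric_space_growth_subset)
  have closed: "\<forall>\<tau> l. range \<tau> \<subseteq> R ` X \<and> limitin mtopology \<tau> l sequentially \<longrightarrow> l \<in> R ` X"
    using \<open>has_closed_range s X R\<close>
    by (simp add: has_closed_range_def metric_closedin_iff_sequentially_closed)
  obtain f \<sigma> where f: "f \<in> hol_disc" "f \<notin> growth_space s" "R f \<in> growth_space0 s"
    and \<sigma>: "\<forall>n::nat. \<sigma> n \<in> growth_space0 s"
    and close: "\<forall>n z. cmod z < 1 \<longrightarrow>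
      cmod (R (\<sigma> n) z - R f z) \<le> 2 * (1 / 2) ^ n * (1 - cmod z) powr (- s)"
    by (rule exists_unbounded_with_small_image)
  have R\<sigma>: "R (\<sigma> n) \<in> growth_space0 s" for n
    using R_growth_space \<sigma> growth_space0_subset by blast
  have "limitin mtopology (\<lambda>n. R (\<sigma> n)) (R f) sequentially"
    unfolding limitin_metric_dist_null
  proof (intro conjI always_eventually allI)
    show "R f \<in> X" "\<And>n. R (\<sigma> n) \<in> X" using f(3) R\<sigma> X(1) by auto
    have "(\<lambda>n. 2 * (1 / 2 :: real) ^ n) \<longlonglongrightarrow> 2 * 0"
      by (intro tendsto_mult_left LIMSEQ_power_zero) auto
    then have null: "(\<lambda>n. 2 * (1 / 2 :: real) ^ n) \<longlonglongrightarrow> 0" by simp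
    show "(\<lambda>n. growth_dist s (R (\<sigma> n)) (R f)) \<longlonglongrightarrow> 0"
    proof (rule Lim_null_comparison[OF _ null])
      have "growth_dist s (R (\<sigma> n)) (R f) \<le> 2 * (1 / 2) ^ n" for n
        using R\<sigma> f(3) growth_space0_subset close by (intro growth_dist_le) auto
      then show "\<forall>\<^sub>F n in sequentially. norm (growth_dist s (R (\<sigma> n)) (R f)) \<le> 2 * (1 / 2) ^ n"
        by (intro always_eventually) simp
    qed
  qed
  moreover have "range (\<lambda>n. R (\<sigma> n)) \<subseteq> R ` X" using \<sigma> X(1) by auto
  ultimately obtain h where h: "h \<in> X" "R f = R h" using closed by blast
  then have "f = h" using f(1) X(2) R_inj by (auto simp: growth_space_iff dest!: inj_onD)
  then show False using f(2) h(1) X(2) by blast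
qed

text \<open>The inclusion also certifies that R maps X into itself, as the reading of
  \<open>has_closed_range\<close> presupposes; the witness f makes it strict.\<close>

lemma psubset_optimal_domain:
  assumes X: "growth_space0 s \<subseteq> X" "X \<subseteq> growth_space s"
  shows "X \<subset> optimal_domain R X"
proof -
  have "X \<subseteq> optimal_domain R X"
  proof
    fix f assume "f \<in> X"
    then have f: "f \<in> growth_space s" using X(2) by blast
    then have "f \<in> hol_disc" "R f \<in> X"
      using R_growth_space X(1) by (auto simp: growth_space_def)
    then show "f \<in> optimal_domain R X" by (simp add: optimal_domain_def)
  qed
  moreover obtain f where "f \<in> hol_disc" "f \<notin> growth_space s" "R f \<in> growth_space0 s"
    by (rule exists_unbounded_with_small_image, erule (2) that)
  then have "f \<in> optimal_domain R X" "f \<notin> X" using X by (auto simp: optimal_domain_def)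
  ultimately show ?thesis by blast
qed

end

section \<open>The two concrete operators\<close>

lemma integrand_holomorphic:
  assumes "f \<in> hol_disc" "g \<in> hol_disc"
  shows "(\<lambda>\<xi>. f \<xi> * deriv g \<xi>) holomorphic_on unit_disc"
  using assms by (intro holomorphic_intros) (auto simp: hol_disc_iff)

lemma V_op_0 [simp]: "V_op g f 0 = 0"
  by (simp add: V_op_def)

text \<open>The disc is convex, so the integrand has a primitive F there, and the segment integral
  from 0 to w is \<open>F w - F 0\<close>.\<close>

lemma V_op_has_field_derivative:
  assumes f: "f \<in> hol_disc" and g: "g \<in> hol_disc" and z: "cmod z < 1"
  shows "(V_op g f has_field_derivative f z * deriv g z) (at z)"
proof -
  let ?h = "\<lambda>\<xi>. f \<xi> * deriv g \<xi>"
  obtain F where F: "\<And>x. x \<in> unit_disc \<Longrightarrow> (F has_field_derivative ?h x) (at x within unit_disc)"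
    using holomorphic_convex_primitive'[OF _ _ integrand_holomorphic[OF f g]] by auto
  have V: "V_op g f w = F w - F 0" if w: "cmod w < 1" for w
  proof -
    have "path_image (linepath 0 w) \<subseteq> unit_disc"
      unfolding path_image_linepath using w by (intro closed_segment_subset) auto
    from contour_integral_unique[OF contour_integral_primitive[OF F _ this]] w
    show ?thesis by (simp add: V_op_def)
  qed
  have "((\<lambda>w. F w - F 0) has_field_derivative ?h z) (at z)"
    using F[of z] z at_within_open[of z unit_disc] by (auto intro!: derivative_eq_intros)
  then show ?thesis
    by (rule has_field_derivative_transform_within_open[where S = unit_disc]) (use z V in auto)
qed

lemma V_op_hol_disc:
  assumes "f \<in> hol_disc" "g \<in> hol_disc"
  shows "V_op g f \<in> hol_disc"
  unfolding hol_disc_iff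
proof
  show "V_op g f holomorphic_on unit_disc"
    unfolding holomorphic_on_open[OF open_ball]
    using V_op_has_field_derivative[OF assms] by (meson mem_ball_0)
qed (simp add: V_op_def)

lemma V_op_linear:
  assumes f: "f \<in> hol_disc" and h: "h \<in> hol_disc" and g: "g \<in> hol_disc" and z: "cmod z < 1"
  shows "V_op g (\<lambda>z\<in>unit_disc. f z + c * h z) z = V_op g f z + c * V_op g h z"
proof -
  have seg: "closed_segment 0 z \<subseteq> unit_disc"
    using z by (intro closed_segment_subset) auto
  have int: "(\<lambda>\<xi>. k \<xi> * deriv g \<xi>) contour_integrable_on linepath 0 z" if "k \<in> hol_disc" for k
    using holomorphic_on_imp_continuous_on[OF integrand_holomorphic[OF that g]] seg
    by (intro contour_integrable_continuous_linepath) (rule continuous_on_subset)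
  have "contour_integral (linepath 0 z) (\<lambda>\<xi>. (\<lambda>z\<in>unit_disc. f z + c * h z) \<xi> * deriv g \<xi>)
      = contour_integral (linepath 0 z) (\<lambda>\<xi>. f \<xi> * deriv g \<xi> + c * (h \<xi> * deriv g \<xi>))"
    using seg by (intro contour_integral_eq) (auto simp: algebra_simps)
  then show ?thesis
    using z int[OF f] int[OF h]
    by (simp add: V_op_def contour_integral_add contour_integral_lmul contour_integrable_lmul)
qed

text \<open>Differentiating gives equality of f and h wherever \<open>deriv g\<close> is nonzero. As
  g is not constant, this is a nonempty open set, and the identity theorem extends the equality to
  the disc.\<close>

lemma V_op_inj:
  assumes g: "g \<in> hol_disc" and nc: "\<not> g constant_on unit_disc"
  shows "inj_on (V_op g) hol_disc"
proof (rule inj_onI)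
  fix f h assume f: "f \<in> hol_disc" and h: "h \<in> hol_disc" and eq: "V_op g f = V_op g h"
  have hg: "g holomorphic_on unit_disc" using g by (simp add: hol_disc_iff)
  have dg: "deriv g holomorphic_on unit_disc" using hg by (rule holomorphic_deriv) simp
  have mult_eq: "f z * deriv g z = h z * deriv g z" if "cmod z < 1" for z
    using DERIV_unique[OF V_op_has_field_derivative[OF f g that, unfolded eq]
        V_op_has_field_derivative[OF h g that]] .
  have "\<exists>p\<in>unit_disc. deriv g p \<noteq> 0"
  proof (rule ccontr)
    assume "\<not> ?thesis"
    then have "(g has_field_derivative 0) (at z within unit_disc)" if "z \<in> unit_disc" for z
      using holomorphic_derivI[OF hg open_ball that] that by simp
    from has_field_derivative_zero_constant[OF convex_ball this] nc
    show False by (auto simp: constant_on_def)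
  qed
  then obtain p where p: "p \<in> unit_disc" "deriv g p \<noteq> 0" by blast
  define S where "S = unit_disc \<inter> deriv g -` (- {0})"
  have "open S"
    unfolding S_def
    by (intro continuous_open_preimage holomorphic_on_imp_continuous_on[OF dg]) auto
  have "f z = h z" if "z \<in> unit_disc" for z
  proof (rule analytic_continuation_open[of S unit_disc f h])
    show "S \<noteq> {}" using p by (auto simp: S_def)
    show "f w = h w" if "w \<in> S" for w using that mult_eq[of w] by (simp add: S_def)
  qed (use f h that \<open>open S\<close> in \<open>auto simp: S_def hol_disc_iff\<close>)
  then show "f = h" using f h by (intro extensionalityI[of f unit_disc]) (auto simp: hol_disc_iff)
qed

text \<open>The factor \<open>cmod z\<close> is kept so that \<open>T_op_bound\<close> can divide by
  it.\<close>

lemma V_op_bound: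
  assumes f: "f \<in> hol_disc" and g: "g \<in> hol_disc" and s: "s > 0"
    and "cmod z < 1" "C \<ge> 0" "D \<ge> 0"
    and "\<And>\<xi>. cmod \<xi> \<le> cmod z \<Longrightarrow>
        cmod (f \<xi> * deriv g \<xi>) \<le> C + D * (1 - cmod \<xi>) powr (- s - 1)"
  shows "cmod (V_op g f z) \<le> cmod z * (C + volterra_const s * D * (1 - cmod z) powr (- s))"
  using assms by (intro primitive_bound[OF s _ _ _ V_op_has_field_derivative[OF f g]]) auto

lemma T_op_eq:
  "cmod z < 1 \<Longrightarrow> T_op g f z = (if z = 0 then f 0 * deriv g 0 else V_op g f z / z)"
  by (simp add: T_op_def V_op_def)

text \<open>The singularity at 0 is removable: the prescribed value there is the derivative of
  \<open>V_op g f\<close>, which vanishes at 0.\<close>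

lemma T_op_hol_disc:
  assumes "f \<in> hol_disc" "g \<in> hol_disc"
  shows "T_op g f \<in> hol_disc"
  unfolding hol_disc_iff
proof
  have d: "deriv (V_op g f) 0 = f 0 * deriv g 0"
    using V_op_has_field_derivative[OF assms, of 0] by (simp add: DERIV_imp_deriv)
  have "(\<lambda>z. if z = 0 then deriv (V_op g f) 0 else (V_op g f z - V_op g f 0) / (z - 0))
      holomorphic_on unit_disc"
    using V_op_hol_disc[OF assms] by (intro pole_lemma) (auto simp: hol_disc_iff)
  then show "T_op g f holomorphic_on unit_disc"
    by (rule holomorphic_transform) (simp add: T_op_eq d)
qed (simp add: T_op_def)

lemma T_op_bound:
  assumes f: "f \<in> hol_disc" and g: "g \<in> hol_disc" and s: "s > 0"
    and z: "cmod z < 1" and C: "C \<ge> 0" and D: "D \<ge> 0"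
    and h: "\<And>\<xi>. cmod \<xi> \<le> cmod z \<Longrightarrow>
        cmod (f \<xi> * deriv g \<xi>) \<le> C + D * (1 - cmod \<xi>) powr (- s - 1)"
  shows "cmod (T_op g f z) \<le> C + volterra_const s * D * (1 - cmod z) powr (- s)"
proof (cases "z = 0")
  case True
  \<comment> \<open>At the origin nothing is integrated and the weight is 1, so the hypothesis
    itself gives C + D; this is where the constant must be at least 1.\<close>
  have "D \<le> volterra_const s * D"
    using volterra_const_ge_1[OF s] D mult_right_mono[of 1 "volterra_const s" D] by simp
  then show ?thesis using h[of 0] True by (simp add: T_op_eq)
next
  case False
  then show ?thesis
    using V_op_bound[OF f g s z C D h] z
    by (simp add: T_op_eq norm_divide pos_divide_le_eq mult.commute)
qed

lemma T_op_inj: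
  assumes g: "g \<in> hol_disc" and nc: "\<not> g constant_on unit_disc"
  shows "inj_on (T_op g) hol_disc"
proof (rule inj_onI)
  fix f h assume f: "f \<in> hol_disc" and h: "h \<in> hol_disc" and eq: "T_op g f = T_op g h"
  have "V_op g f = V_op g h"
  proof (rule extensionalityI[of _ unit_disc])
    fix z :: complex assume z: "z \<in> unit_disc"
    then show "V_op g f z = V_op g h z"
      \<comment> \<open>Multiplying by z recovers \<open>V_op\<close> away from the origin, and at
        the origin both sides vanish.\<close>
      using fun_cong[OF eq, of z] by (cases "z = 0") (auto simp: T_op_eq)
  qed (auto simp: V_op_def)
  then show "f = h" using V_op_inj[OF assms] f h by (auto dest: inj_onD)
qed

lemma volterra_operator_V_op:
  assumes "g \<in> little_bloch" "\<not> g constant_on unit_disc" "s > 0"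
  shows "volterra_operator g s (volterra_const s) (V_op g)"
proof
  have g: "g \<in> hol_disc" using assms(1) by (simp add: little_bloch_def bloch_def)
  show "inj_on (V_op g) hol_disc" using g assms(2) by (rule V_op_inj)
  fix f z C D
  assume f: "f \<in> hol_disc"
  then show "V_op g f \<in> hol_disc" using g by (rule V_op_hol_disc)
  show "V_op g (\<lambda>z\<in>unit_disc. f z + c * h z) z = V_op g f z + c * V_op g h z"
    if "h \<in> hol_disc" "cmod z < 1" for h c using V_op_linear[OF f that(1) g that(2)] .
  assume z: "cmod z < 1" and CD: "C \<ge> 0" "D \<ge> 0"
    and h: "\<And>\<xi>. cmod \<xi> \<le> cmod z \<Longrightarrow>
        cmod (f \<xi> * deriv g \<xi>) \<le> C + D * (1 - cmod \<xi>) powr (- s - 1)"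
  have "cmod (V_op g f z) \<le> cmod z * (C + volterra_const s * D * (1 - cmod z) powr (- s))"
    by (rule V_op_bound[OF f g assms(3) z CD h])
  also have "\<dots> \<le> 1 * (C + volterra_const s * D * (1 - cmod z) powr (- s))"
    using z CD volterra_const_ge_1[OF assms(3)] by (intro mult_right_mono) auto
  finally show "cmod (V_op g f z) \<le> C + volterra_const s * D * (1 - cmod z) powr (- s)" by simp
qed (use assms volterra_const_ge_1 in auto)

lemma volterra_operator_T_op:
  assumes "g \<in> little_bloch" "\<not> g constant_on unit_disc" "s > 0"
  shows "volterra_operator g s (volterra_const s) (T_op g)"
proof
  have g: "g \<in> hol_disc" using assms(1) by (simp add: little_bloch_def bloch_def)
  show "inj_on (T_op g) hol_disc" using g assms(2) by (rule T_op_inj)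
  fix f z C D
  assume f: "f \<in> hol_disc"
  then show "T_op g f \<in> hol_disc" using g by (rule T_op_hol_disc)
  show "T_op g (\<lambda>z\<in>unit_disc. f z + c * h z) z = T_op g f z + c * T_op g h z"
    if "h \<in> hol_disc" "cmod z < 1" for h c
    using V_op_linear[OF f that(1) g that(2)] that(2)
    by (simp add: T_op_eq add_divide_distrib algebra_simps)
  assume "cmod z < 1" "C \<ge> 0" "D \<ge> 0"
    "\<And>\<xi>. cmod \<xi> \<le> cmod z \<Longrightarrow> cmod (f \<xi> * deriv g \<xi>) \<le> C + D * (1 - cmod \<xi>) powr (- s - 1)"
  then show "cmod (T_op g f z) \<le> C + volterra_const s * D * (1 - cmod z) powr (- s)"
    by (rule T_op_bound[OF f g assms(3)])
qed (use assms volterra_const_ge_1 in auto)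

theorem proposition5p9:
  fixes g :: "complex \<Rightarrow> complex" and \<gamma> :: real
  assumes "g \<in> little_bloch"
    and "\<not> g constant_on unit_disc"
    and "\<gamma> > 0"
  shows "(\<not> has_closed_range \<gamma> (growth_space \<gamma>) (V_op g) \<and>
          \<not> has_closed_range \<gamma> (growth_space0 \<gamma>) (V_op g)) \<and>
         (growth_space \<gamma> \<subset> optimal_domain (V_op g) (growth_space \<gamma>) \<and>
          growth_space0 \<gamma> \<subset> optimal_domain (V_op g) (growth_space0 \<gamma>)) \<and>
         (\<not> has_closed_range \<gamma> (growth_space \<gamma>) (T_op g) \<and>
          \<not> has_closed_range \<gamma> (growth_space0 \<gamma>) (T_op g)) \<and>
         (growth_space \<gamma> \<subset> optimal_domain (T_op g) (growth_space \<gamma>) \<and>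
          growth_space0 \<gamma> \<subset> optimal_domain (T_op g) (growth_space0 \<gamma>))"
proof -
  interpret V: volterra_operator g \<gamma> "volterra_const \<gamma>" "V_op g"
    using assms by (rule volterra_operator_V_op)
  interpret T: volterra_operator g \<gamma> "volterra_const \<gamma>" "T_op g"
    using assms by (rule volterra_operator_T_op)
  show ?thesis
    by (intro conjI V.not_has_closed_range V.psubset_optimal_domain
        T.not_has_closed_range T.psubset_optimal_domain growth_space0_subset order_refl)
qed

end
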